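(* Let $d\ge 1$ and let $\mathcal{B}_1,\dots,\mathcal{B}_{2d}$ be nonempty finite families of boxes in $\mathbb{R}^d$ (not necessarily distinct or disjoint). Then there is a selection $B_i\in\mathcal{B}_i$ for each $i\in\{1,\dots,2d\}$ and an index $\ell\in\{1,\dots,2d\}$ such that $\bigcap_{i=1}^{2d}B_i\subseteq\bigcap\mathcal{B}_\ell$.
   Context: A box in $\mathbb{R}^d$ is an axis-parallel box, i.e. a set of the form $[a_1,b_1]\times\cdots\times[a_d,b_d]$ (equivalently, an intersection of $2d$ closed coordinate halfspaces, one for each direction $\pm e_i$); degenerate boxes and the empty set are allowed. For a family $\mathcal{B}$, $\bigcap\mathcal{B}$ denotes the intersection of all its members. *)

theory Defs
  imports "HOL-Analysis.Analysis"
begin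

(* cbox a b = {x. \<forall>i. a $ i \<le> x $ i \<and> x $ i \<le> b $ i} (see mem_box_cart), with no constraint
   relating a and b: it is degenerate if a $ i = b $ i for some i, and empty if
   a $ i > b $ i for some i. *)
definition is_box :: "(real ^ 'n) set \<Rightarrow> bool" where
  "is_box S \<longleftrightarrow> (\<exists>a b. S = cbox a b)"

end

theory Submission
  imports Defs
begin

text \<open>
  A box is an intersection of \<open>2 d\<close> halfspaces, one for each direction \<open>\<plusminus>e\<^sub>k\<close>, and there are as many
  families as directions. A greedy choice matches them up: treat the directions one at a time, and
  for each take a box whose halfspace in that direction is smallest among all boxes of the families
  not used so far; its family is then used up. Let \<open>l\<close> be the family used by the last direction.
  It was still unused in every step, so in each direction the box chosen there is at least as
  restrictive as every box of the family \<open>l\<close>. Hence the intersection of the chosen boxes lies in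
  every box of that family. The greedy choice is the lemma \<open>greedy_transversal\<close>; the theorem applies
  it to the signed offsets of the facets.
\<close>

text \<open>
  Induction on \<open>J\<close>: the box for the new direction minimises over all families still available, so it
  does at least as well as every box of the family \<open>l\<close>, whichever \<open>l\<close> the induction hypothesis
  returns for the remaining families and directions.
\<close>
lemma greedy_transversal:
  fixes offset :: "'j \<Rightarrow> 'b \<Rightarrow> 'v :: linorder"
    and \<B> :: "'i \<Rightarrow> 'b set"
  assumes "finite J" "J \<noteq> {}" "card C = card J"
    and "\<And>i. i \<in> C \<Longrightarrow> finite (\<B> i)" "\<And>i. i \<in> C \<Longrightarrow> \<B> i \<noteq> {}"
  shows "\<exists>B l. (\<forall>i\<in>C. B i \<in> \<B> i) \<and> l \<in> C \<and>
           (\<forall>j\<in>J. \<exists>i\<in>C. \<forall>S\<in>\<B> l. offset j (B i) \<le> offset j S)"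
proof -
  have minimiser: "\<exists>c\<in>D. \<exists>T\<in>\<B> c. \<forall>i\<in>D. \<forall>S\<in>\<B> i. offset j T \<le> offset j S"
    if D: "finite D" "D \<noteq> {}" "D \<subseteq> C" for D j
  proof -
    have fin: "finite (\<Union>i\<in>D. \<B> i)"
      using D(1,3) assms(4) by (intro finite_UN_I) auto
    obtain d where "d \<in> D" using D(2) by blast
    then have "\<B> d \<noteq> {}" using D(3) assms(5) by blast
    with \<open>d \<in> D\<close> have "offset j ` (\<Union>i\<in>D. \<B> i) \<noteq> {}" by blast
    from ex_min_if_finite[OF finite_imageI[OF fin] this]
    obtain m where m: "m \<in> offset j ` (\<Union>i\<in>D. \<B> i)"
        "\<not> (\<exists>v\<in>offset j ` (\<Union>i\<in>D. \<B> i). v < m)"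
      by blast
    then show ?thesis by (auto simp: not_less)
  qed
  have "\<exists>B l. (\<forall>i\<in>D. B i \<in> \<B> i) \<and> l \<in> D \<and>
           (\<forall>j\<in>J. \<exists>i\<in>D. \<forall>S\<in>\<B> l. offset j (B i) \<le> offset j S)"
    if "card D = card J" "D \<subseteq> C" for D
    using assms(1,2) that
  proof (induction J arbitrary: D rule: finite_ne_induct)
    case (singleton x)
    then obtain l where D: "D = {l}" by (auto simp: card_1_singleton_iff)
    obtain T where "T \<in> \<B> l" "\<forall>S\<in>\<B> l. offset x T \<le> offset x S"
      using minimiser[of D x] singleton D by auto
    then show ?case using D by (intro exI[of _ "\<lambda>_. T"] exI[of _ l]) auto
  next
    case (insert x J)
    have fin: "finite D" "D \<noteq> {}"
      using insert.hyps insert.prems by (auto intro: card_ge_0_finite)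
    obtain c T where c: "c \<in> D" "T \<in> \<B> c"
      and T: "\<And>i S. i \<in> D \<Longrightarrow> S \<in> \<B> i \<Longrightarrow> offset x T \<le> offset x S"
      using minimiser[OF fin, of x] insert.prems by blast
    have "card (D - {c}) = card J" "D - {c} \<subseteq> C"
      using insert.hyps insert.prems c fin by auto
    from insert.IH[OF this] obtain B l where B: "\<forall>i\<in>D - {c}. B i \<in> \<B> i" "l \<in> D - {c}"
      "\<forall>j\<in>J. \<exists>i\<in>D - {c}. \<forall>S\<in>\<B> l. offset j (B i) \<le> offset j S"
      by blast
    have "\<exists>i\<in>D. \<forall>S\<in>\<B> l. offset j ((B(c := T)) i) \<le> offset j S" if "j \<in> insert x J" for j
    proof (cases "j = x")
      case True
      have "\<forall>S\<in>\<B> l. offset x T \<le> offset x S" using T B(2) by blast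
      with True have "\<forall>S\<in>\<B> l. offset j ((B(c := T)) c) \<le> offset j S" by simp
      then show ?thesis using c(1) by (rule bexI)
    next
      case False
      then have "j \<in> J" using that by simp
      from bspec[OF B(3) this]
      obtain i where "i \<in> D - {c}" "\<forall>S\<in>\<B> l. offset j (B i) \<le> offset j S" ..
      then have "i \<in> D" "\<forall>S\<in>\<B> l. offset j ((B(c := T)) i) \<le> offset j S" by simp_all
      then show ?thesis by (rule bexI[rotated])
    qed
    moreover have "\<forall>i\<in>D. (B(c := T)) i \<in> \<B> i" "l \<in> D"
      using B(1,2) c by simp_all
    ultimately show ?case by blast
  qed
  then show ?thesis using assms(3) by blast
qed

theorem theorem1p3:
  fixes \<B> :: "nat \<Rightarrow> (real ^ 'n) set set"
  assumes "\<And>i. i \<in> {1..2 * CARD('n)} \<Longrightarrow> finite (\<B> i)"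
    and "\<And>i. i \<in> {1..2 * CARD('n)} \<Longrightarrow> \<B> i \<noteq> {}"
    and "\<And>i S. i \<in> {1..2 * CARD('n)} \<Longrightarrow> S \<in> \<B> i \<Longrightarrow> is_box S"
  shows "\<exists>B l. (\<forall>i\<in>{1..2 * CARD('n)}. B i \<in> \<B> i) \<and> l \<in> {1..2 * CARD('n)} \<and>
           (\<Inter>i\<in>{1..2 * CARD('n)}. B i) \<subseteq> \<Inter> (\<B> l)"
proof -
  let ?C = "{1..2 * CARD('n)}"
  have "\<forall>S :: (real ^ 'n) set. \<exists>a b. is_box S \<longrightarrow> S = cbox a b"
    unfolding is_box_def by blast
  \<comment> \<open>An empty box has many pairs of corners. Any one of them serves, since only membership in \<open>S\<close>
    is ever read off from the corners.\<close>
  then obtain lo hi :: "(real ^ 'n) set \<Rightarrow> real ^ 'n"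
    where box: "\<And>S. is_box S \<Longrightarrow> S = cbox (lo S) (hi S)"
    unfolding choice_iff by blast
  have mem: "x \<in> S \<longleftrightarrow> (\<forall>k. lo S $ k \<le> x $ k \<and> x $ k \<le> hi S $ k)" if "is_box S" for x S
  proof -
    have "x \<in> S \<longleftrightarrow> x \<in> cbox (lo S) (hi S)"
      by (rule arg_cong[OF box[OF that]])
    then show ?thesis by (simp only: mem_box_cart)
  qed
  \<comment> \<open>Direction \<open>(k, True)\<close> is \<open>e\<^sub>k\<close> and \<open>(k, False)\<close> is \<open>- e\<^sub>k\<close>. The sign of the lower
    bound makes smaller offsets mean smaller halfspaces in both cases.\<close>
  define offset where "offset = (\<lambda>(k, up) S. if up then hi S $ k else - (lo S $ k))"
  have "card ?C = card (UNIV :: ('n \<times> bool) set)"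
    by simp
  from greedy_transversal[where \<B> = \<B> and offset = offset,
      OF finite UNIV_not_empty this assms(1,2)]
  obtain B l where B: "\<And>i. i \<in> ?C \<Longrightarrow> B i \<in> \<B> i" and l: "l \<in> ?C"
    and tight: "\<And>j. \<exists>i\<in>?C. \<forall>S\<in>\<B> l. offset j (B i) \<le> offset j S"
    by blast
  have "x \<in> S" if x: "\<And>i. i \<in> ?C \<Longrightarrow> x \<in> B i" and S: "S \<in> \<B> l" for x S
  proof -
    have bounds: "lo (B i) $ k \<le> x $ k \<and> x $ k \<le> hi (B i) $ k" if "i \<in> ?C" for i k
      using x[OF that] mem[OF assms(3)[OF that B[OF that]]] by blast
    have "lo S $ k \<le> x $ k \<and> x $ k \<le> hi S $ k" for k
    proof
      obtain i where "i \<in> ?C" "lo S $ k \<le> lo (B i) $ k"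
        using tight[of "(k, False)"] S by (auto simp: offset_def)
      then show "lo S $ k \<le> x $ k" using bounds[of i k] by linarith
      obtain i where "i \<in> ?C" "hi (B i) $ k \<le> hi S $ k"
        using tight[of "(k, True)"] S by (auto simp: offset_def)
      then show "x $ k \<le> hi S $ k" using bounds[of i k] by linarith
    qed
    then show ?thesis
      using mem[OF assms(3)[OF l S]] by blast
  qed
  then have "(\<Inter>i\<in>?C. B i) \<subseteq> \<Inter> (\<B> l)" by blast
  with B l show ?thesis by blast
qed

end
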